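(* Let $n\geq 1$, $\sigma\geq 1$, $\alpha\in[0,1]$, $s\geq 0$, $\kappa\in[0,1]$, and let $w_0\in H^s\cap L^{1,\kappa}$ (with values in $\mathbb{C}^3$). Let $w$ be the solution of $$w_t-D_0(-\Delta)^{\sigma/2}w-D_1(-\Delta)^{\sigma\alpha}w=0\quad (x\in\mathbb{R}^n,\ t>0),\qquad w(0,x)=w_0(x).$$ Then there is a constant $c>0$ such that, for all $t\geq0$ and all $s_0$ with $0\leq s_0\leq s$, the following estimates hold, with implicit constants independent of $t$ and $w_0$. If $\alpha\in[0,1/2]$: $$\|w(t,\cdot)\|_{\dot H^{s_0}}\lesssim (1+t)^{-\frac{n+2(s_0+\kappa)}{2(2\sigma-2\sigma\alpha)}}\|w_0\|_{L^{1,\kappa}}+e^{-ct}\|w_0\|_{H^{s_0}}+(1+t)^{-\frac{n+2s_0}{2(2\sigma-2\sigma\alpha)}}|P_{w_0}|.$$ If $\alpha\in(1/2,1]$: $$\|w(t,\cdot)\|_{\dot H^{s_0}}\lesssim (1+t)^{-\frac{n+2(s_0+\kappa)}{4\sigma\alpha}}\|w_0\|_{L^{1,\kappa}}+e^{-ct}\|w_0\|_{H^{s_0}}+(1+t)^{-\frac{n+2s_0}{4\sigma\alpha}}|P_{w_0}|.$$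
   Context: The coefficient matrices are $$D_0=\begin{pmatrix} i-\frac12&-\frac12&0\\-\frac12&-i-\frac12&0\\0&0&0\end{pmatrix},\qquad D_1=\begin{pmatrix}0&0&1\\0&0&1\\-\frac12&-\frac12&-1\end{pmatrix}.$$ $(-\Delta)^{\nu}$ is the Fourier multiplier with symbol $|\xi|^{2\nu}$ (the identity if $\nu=0$); the solution is understood through the Fourier transform in $x$, i.e. $\hat w_t=(D_0|\xi|^\sigma+D_1|\xi|^{2\sigma\alpha})\hat w$, $\hat w(0,\xi)=\hat w_0(\xi)$. (The system arises from $u_{tt}+\mathcal{A}u-\mathcal{A}^{\alpha}v+\mathcal{A}^{1/2}u_t=0$, $v_t+\mathcal{A}^{\alpha}v+\mathcal{A}^{\alpha}u_t=0$, $\mathcal{A}=(-\Delta)^\sigma$, via $w=(u_t+i(-\Delta)^{\sigma/2}u,\,u_t-i(-\Delta)^{\sigma/2}u,\,v)^{\mathrm T}$.) $H^s$ and $\dot H^s$ are the Bessel and Riesz potential spaces on $\mathbb{R}^n$ based on $L^2$; $L^{1,\kappa}$ is the space of $f\in L^1$ with $\|f\|_{L^{1,\kappa}}=\int_{\mathbb{R}^n}(1+|x|)^\kappa|f(x)|\,dx<\infty$; $P_f=\int_{\mathbb{R}^n}f(x)\,dx$; $f\lesssim g$ means $f\le Cg$ for some constant $C>0$. *)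

theory Defs
  imports "HOL-Analysis.Analysis"
begin

definition D0 :: "complex^3^3" where
  "D0 = vector [vector [\<i> - 1/2, - 1/2, 0],
                vector [- 1/2, - \<i> - 1/2, 0],
                vector [0, 0, 0]]"

definition D1 :: "complex^3^3" where
  "D1 = vector [vector [0, 0, 1],
                vector [0, 0, 1],
                vector [- 1/2, - 1/2, - 1]]"

definition L2 :: "(real^'n \<Rightarrow> complex^'m) set" where
  "L2 = {f. f \<in> borel_measurable lebesgue \<and> integrable lebesgue (\<lambda>x. (norm (f x))\<^sup>2)}"

definition L2_norm :: "(real^'n \<Rightarrow> complex^'m) \<Rightarrow> real" where
  "L2_norm f = sqrt (LINT x|lebesgue. (norm (f x))\<^sup>2)"

definition weighted_L1 :: "real \<Rightarrow> (real^'n \<Rightarrow> complex^'m) set" where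
  "weighted_L1 \<kappa> = {f. integrable lebesgue f \<and>
     integrable lebesgue (\<lambda>x. (1 + norm x) powr \<kappa> * norm (f x))}"

definition weighted_L1_norm :: "real \<Rightarrow> (real^'n \<Rightarrow> complex^'m) \<Rightarrow> real" where
  "weighted_L1_norm \<kappa> f = (LINT x|lebesgue. (1 + norm x) powr \<kappa> * norm (f x))"

definition total_mass :: "(real^'n \<Rightarrow> complex^'m) \<Rightarrow> complex^'m" where
  "total_mass f = (LINT x|lebesgue. f x)"

text \<open>The Fourier transform of an integrable function, in the unitary normalisation
  (so that the Bessel norm of order 0 is the norm of \<open>L2\<close>).\<close>

definition fourier_L1 :: "(real^'n \<Rightarrow> complex^'m) \<Rightarrow> real^'n \<Rightarrow> complex^'m" where
  "fourier_L1 f \<xi> = ((2 * pi) powr (- real CARD('n) / 2)) *\<^sub>R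
     (LINT x|lebesgue. cis (- (x \<bullet> \<xi>)) *s f x)"

text \<open>The Fourier--Plancherel transform of a square integrable function is the limit in mean
  square of the transforms of its truncations to balls. Like every element of \<open>L2\<close>, it is
  determined only up to a null set. Convergence is stated with the nonnegative integral because
  the Bochner integral of a non-integrable function is 0 by convention.\<close>

definition has_fourier_L2 :: "(real^'n \<Rightarrow> complex^'m) \<Rightarrow> (real^'n \<Rightarrow> complex^'m) \<Rightarrow> bool" where
  "has_fourier_L2 f g \<longleftrightarrow> f \<in> L2 \<and> g \<in> L2 \<and>
     ((\<lambda>R. \<integral>\<^sup>+\<xi>. ennreal ((norm (fourier_L1 (\<lambda>x. indicator (cball 0 R) x *\<^sub>R f x) \<xi> - g \<xi>))\<^sup>2)
        \<partial>lebesgue) \<longlongrightarrow> 0) at_top"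

definition fourier_L2 :: "(real^'n \<Rightarrow> complex^'m) \<Rightarrow> real^'n \<Rightarrow> complex^'m" where
  "fourier_L2 f = (SOME g. has_fourier_L2 f g)"

text \<open>The symbol of \<open>(-\<Delta>)\<^sup>\<nu>\<close>. The case distinction only matters at \<open>\<xi> = 0\<close>, since
  \<open>0 powr 0 = 0\<close>.\<close>

definition laplacian_symbol :: "real \<Rightarrow> real^'n \<Rightarrow> real" where
  "laplacian_symbol \<nu> \<xi> = (if \<nu> = 0 then 1 else norm \<xi> powr (2 * \<nu>))"

text \<open>Bessel and Riesz potential spaces of order \<open>s \<ge> 0\<close>. The Bessel space is contained in
  \<open>L2\<close>. Of the Riesz space only the elements that lie in \<open>L2\<close> are considered; the solution
  is of this kind at every time.\<close>

definition bessel_space :: "real \<Rightarrow> (real^'n \<Rightarrow> complex^'m) set" where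
  "bessel_space s = {f. (\<exists>g. has_fourier_L2 f g) \<and>
     (\<lambda>\<xi>. (1 + (norm \<xi>)\<^sup>2) powr (s / 2) *\<^sub>R fourier_L2 f \<xi>) \<in> L2}"

definition bessel_norm :: "real \<Rightarrow> (real^'n \<Rightarrow> complex^'m) \<Rightarrow> real" where
  "bessel_norm s f = L2_norm (\<lambda>\<xi>. (1 + (norm \<xi>)\<^sup>2) powr (s / 2) *\<^sub>R fourier_L2 f \<xi>)"

definition riesz_space :: "real \<Rightarrow> (real^'n \<Rightarrow> complex^'m) set" where
  "riesz_space s = {f. (\<exists>g. has_fourier_L2 f g) \<and>
     (\<lambda>\<xi>. laplacian_symbol (s / 2) \<xi> *\<^sub>R fourier_L2 f \<xi>) \<in> L2}"

definition riesz_norm :: "real \<Rightarrow> (real^'n \<Rightarrow> complex^'m) \<Rightarrow> real" where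
  "riesz_norm s f = L2_norm (\<lambda>\<xi>. laplacian_symbol (s / 2) \<xi> *\<^sub>R fourier_L2 f \<xi>)"

text \<open>The Cauchy problem for \<open>w\<^sub>t - D\<^sub>0 (-\<Delta>)\<^bsup>\<sigma>/2\<^esup> w - D\<^sub>1 (-\<Delta>)\<^bsup>\<sigma>\<alpha>\<^esup> w = 0\<close>, understood through the
  Fourier transform in \<open>x\<close>. Since the transform at each time is determined only almost
  everywhere, the definition asks for a family \<open>W\<close> of representatives that solves the ordinary
  differential equation classically for almost every frequency.\<close>

definition solves_cauchy_problem ::
    "real \<Rightarrow> real \<Rightarrow> (real^'n \<Rightarrow> complex^3) \<Rightarrow> (real \<Rightarrow> real^'n \<Rightarrow> complex^3) \<Rightarrow> bool" where
  "solves_cauchy_problem \<sigma> \<alpha> w0 w \<longleftrightarrow>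
     (\<exists>W. (\<forall>t\<ge>0. has_fourier_L2 (w t) (W t)) \<and>
        (AE \<xi> in lebesgue.
           continuous_on {0..} (\<lambda>t. W t \<xi>) \<and>
           (\<forall>t>0. ((\<lambda>t. W t \<xi>) has_vector_derivative
              (laplacian_symbol (\<sigma> / 2) \<xi> *\<^sub>R D0 + laplacian_symbol (\<sigma> * \<alpha>) \<xi> *\<^sub>R D1) *v W t \<xi>) (at t)) \<and>
           W 0 \<xi> = fourier_L2 w0 \<xi>))"

end

theory Submission
  imports Defs
begin

text \<open>
  At a frequency $\xi$ the problem is the linear system $W' = (a D_0 + b D_1) W$ with
  $a = |\xi|^\sigma$ and $b = |\xi|^{2\sigma\alpha}$. In the unknowns
  $p = (W_1 + W_2)/2$, $q = (W_1 - W_2)/(2i)$, $v = W_3$ the energy $|p|^2 + |q|^2 + |v|^2$ is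
  nonincreasing, but only $p$ and $v$ are damped. Adding a small multiple of
  $\min(1, a/b)\, p \cdot q$ turns it into a strict Lyapunov function. This gives
  $|W(t)|^2 \le 4 e^{-\rho t/5} |W(0)|^2$ with $\rho = \min(b, a^2/b)$, with constants that do not
  depend on the frequency (\<open>damped_system_energy_decay\<close>, \<open>frequency_solution_decay\<close>).

  With $\beta = \max(2\sigma\alpha, 2\sigma - 2\sigma\alpha)$, one has $\rho = |\xi|^\beta$ for
  $|\xi| \le 1$ and $\rho \ge 1$ for $|\xi| \ge 1$. The high frequencies therefore contribute at most
  $2 e^{-t/10}$ times the Bessel norm of the data. At low frequencies the data are integrable, hence
  their transform is bounded by $|P_{w_0}| + 2 |\xi|^\kappa \|w_0\|_{L^{1,\kappa}}$
  (\<open>norm_fourier_L1_le\<close>), and the integral of $|\xi|^m e^{-|\xi|^\beta (1+t)/5}$ over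
  $\xi$ is of order $(1+t)^{-(n+m)/\beta}$ (\<open>nn_integral_stretched_exp_le\<close>). Taking
  $m = 2 s_0$ for the mass and $m = 2(s_0 + \kappa)$ for the remainder gives the two algebraic rates.
  For $\alpha \le 1/2$ the exponent $\beta$ is $2\sigma - 2\sigma\alpha$, for $\alpha > 1/2$ it is
  $2\sigma\alpha$, and $c = 1/10$ serves for all parameters.

  The norms refer to a chosen representative of the Fourier--Plancherel transform. Such a
  representative is unique up to a null set (\<open>has_fourier_L2_unique\<close>) and agrees with the transform
  given by the integral when the function is integrable (\<open>fourier_L2_eq_fourier_L1\<close>).
\<close>

section \<open>Decay of the solution at a single frequency\<close>

text \<open>The energy $|p|^2 + |q|^2 + |v|^2$ dissipates only $p$ and $v$. The cross term
  $\frac{\theta}{2}\, p \cdot q$ makes the coupling $q' = a p$, $p' = -a q - \ldots$ visible and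
  produces the missing term $-\frac{\theta}{2} a |q|^2$. The price consists of $\theta b\, v \cdot q$
  and $\theta a\, p \cdot q$; both are absorbed by Young's inequality as long as $\theta b \le a$
  and $\theta \le 1$. The left-hand side is the derivative of the corrected energy along
  \<open>p' = b v - a q - a p\<close>, \<open>q' = a p\<close>, \<open>v' = - b p - b v\<close>.\<close>

lemma energy_dissipation_inequality:
  fixes p q v :: "'a::real_inner" and a b \<theta> \<rho> :: real
  assumes "0 < a" "0 < b" "0 \<le> \<theta>" "\<theta> \<le> 1" "\<theta> * b \<le> a" "\<rho> \<le> \<theta> * a" "\<rho> \<le> b" "0 \<le> \<rho>"
  shows "2 * (p \<bullet> (b *\<^sub>R v - a *\<^sub>R q - a *\<^sub>R p)) + 2 * (q \<bullet> (a *\<^sub>R p)) + 2 * (v \<bullet> (- b *\<^sub>R p - b *\<^sub>R v))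
      + \<theta> / 2 * ((b *\<^sub>R v - a *\<^sub>R q - a *\<^sub>R p) \<bullet> q + p \<bullet> (a *\<^sub>R p))
    \<le> - (\<rho> / 5) * (p \<bullet> p + q \<bullet> q + v \<bullet> v + \<theta> / 2 * (p \<bullet> q))"
proof -
  have ta: "\<theta> * a \<le> a" using assms by (simp add: mult_left_le_one_le)
  \<comment> \<open>Young's inequality, with the weights for which the terms in $q$ leave half of the gain.\<close>
  have "0 \<le> b * ((v - (\<theta>/2) *\<^sub>R q) \<bullet> (v - (\<theta>/2) *\<^sub>R q))" using assms by simp
  also have "\<dots> = b * (v \<bullet> v) - \<theta> * b * (v \<bullet> q) + \<theta> * (\<theta> * b) / 4 * (q \<bullet> q)"
    by (simp add: algebra_simps inner_diff inner_commute power2_eq_square)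
  also have "\<dots> \<le> b * (v \<bullet> v) - \<theta> * b * (v \<bullet> q) + \<theta> * a / 4 * (q \<bullet> q)"
    using assms by (intro add_left_mono mult_right_mono divide_right_mono mult_left_mono) auto
  finally have 1: "\<theta> * b * (v \<bullet> q) \<le> b * (v \<bullet> v) + \<theta> * a / 4 * (q \<bullet> q)" by simp
  have "0 \<le> \<theta> * a * ((p + (1/2) *\<^sub>R q) \<bullet> (p + (1/2) *\<^sub>R q))" using assms by simp
  also have "\<dots> = \<theta> * a * (p \<bullet> p) + \<theta> * a * (p \<bullet> q) + \<theta> * a / 4 * (q \<bullet> q)"
    by (simp add: algebra_simps inner_add inner_commute)
  finally have 2: "- (\<theta> * a * (p \<bullet> q)) \<le> \<theta> * a * (p \<bullet> p) + \<theta> * a / 4 * (q \<bullet> q)" by simp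
  have 3: "\<theta> * a * (p \<bullet> p) \<le> a * (p \<bullet> p)" using ta by (intro mult_right_mono) auto
  have 4: "\<rho> * (p \<bullet> p) \<le> a * (p \<bullet> p)" "\<rho> * (v \<bullet> v) \<le> b * (v \<bullet> v)"
      "\<rho> * (q \<bullet> q) \<le> \<theta> * a * (q \<bullet> q)" "0 \<le> a * (p \<bullet> p)" "0 \<le> b * (v \<bullet> v)"
    using ta assms by (auto intro!: mult_right_mono intro: order_trans[of \<rho> "\<theta> * a" a])
  have "0 \<le> \<theta> * \<rho> * ((p - q) \<bullet> (p - q))" using assms by simp
  also have "\<dots> = \<theta> * (\<rho> * (p \<bullet> p + q \<bullet> q)) - 2 * (\<theta> * \<rho> * (p \<bullet> q))"
    by (simp add: algebra_simps inner_diff inner_commute)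
  also have "\<dots> \<le> 1 * (\<rho> * (p \<bullet> p + q \<bullet> q)) - 2 * (\<theta> * \<rho> * (p \<bullet> q))"
    using assms by (intro diff_right_mono mult_right_mono) auto
  finally have 5: "\<theta> * \<rho> * (p \<bullet> q) \<le> \<rho> * (p \<bullet> p) / 2 + \<rho> * (q \<bullet> q) / 2"
    by (simp add: algebra_simps)
  have 7: "0 \<le> \<rho> * (v \<bullet> v)" using assms by simp
  have "2 * (p \<bullet> (b *\<^sub>R v - a *\<^sub>R q - a *\<^sub>R p)) + 2 * (q \<bullet> (a *\<^sub>R p)) + 2 * (v \<bullet> (- b *\<^sub>R p - b *\<^sub>R v))
      + \<theta> / 2 * ((b *\<^sub>R v - a *\<^sub>R q - a *\<^sub>R p) \<bullet> q + p \<bullet> (a *\<^sub>R p))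
     = - 2 * (a * (p \<bullet> p)) - 2 * (b * (v \<bullet> v))
       + (\<theta> * b * (v \<bullet> q) - \<theta> * a * (q \<bullet> q) - \<theta> * a * (p \<bullet> q) + \<theta> * a * (p \<bullet> p)) / 2"
    unfolding inner_diff_left inner_diff_right inner_scaleR_left inner_scaleR_right
    by (simp add: inner_commute field_simps)
  moreover have "- (\<rho> / 5) * (p \<bullet> p + q \<bullet> q + v \<bullet> v + \<theta> / 2 * (p \<bullet> q))
     = - (\<rho> * (p \<bullet> p) + \<rho> * (q \<bullet> q) + \<rho> * (v \<bullet> v)) / 5 - \<theta> * \<rho> * (p \<bullet> q) / 10"
    by (simp add: field_simps)
  ultimately show ?thesis using 1 2 3 4 5 7 by argo
qed

text \<open>The corrected energy is equivalent to the energy, with factors $3/4$ and $5/4$, so its exponential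
  decay passes to the energy at the cost of the factor $5/3$. The weight
  $\theta = \min(1, a/b)$ is the largest one that meets the two conditions of the dissipation
  inequality. It gives the rate $\theta a$ for $q$, which equals $a$ if $b \le a$ and $a^2/b$ if
  $a \le b$; together with the rate $b$ of $v$ the slowest one is $\min(b, a^2/b)$. All constants
  are independent of $a$ and $b$, so the bound is uniform in the frequency.\<close>

lemma damped_system_energy_decay:
  fixes p q v :: "real \<Rightarrow> 'a::real_inner" and a b :: real
  assumes ab: "0 < a" "0 < b"
    and cont: "continuous_on {0..} p" "continuous_on {0..} q" "continuous_on {0..} v"
    and p: "\<And>t. t > 0 \<Longrightarrow> (p has_vector_derivative b *\<^sub>R v t - a *\<^sub>R q t - a *\<^sub>R p t) (at t)"
    and q: "\<And>t. t > 0 \<Longrightarrow> (q has_vector_derivative a *\<^sub>R p t) (at t)"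
    and v: "\<And>t. t > 0 \<Longrightarrow> (v has_vector_derivative - b *\<^sub>R p t - b *\<^sub>R v t) (at t)"
    and t: "0 \<le> t"
  shows "(norm (p t))\<^sup>2 + (norm (q t))\<^sup>2 + (norm (v t))\<^sup>2
    \<le> 5 / 3 * exp (- (min b (a\<^sup>2 / b) * t / 5)) * ((norm (p 0))\<^sup>2 + (norm (q 0))\<^sup>2 + (norm (v 0))\<^sup>2)"
proof -
  define \<theta> where "\<theta> = min 1 (a / b)"
  define \<rho> where "\<rho> = min b (a\<^sup>2 / b)"
  define E where "E = (\<lambda>t. p t \<bullet> p t + q t \<bullet> q t + v t \<bullet> v t)"
  define L where "L = (\<lambda>t. E t + \<theta> / 2 * (p t \<bullet> q t))"
  have \<theta>: "0 \<le> \<theta>" "\<theta> \<le> 1" "\<theta> * b \<le> a" using ab by (auto simp: \<theta>_def min_def field_simps)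
  have \<rho>: "0 \<le> \<rho>" "\<rho> \<le> b" using ab by (auto simp: \<rho>_def)
  have \<rho>': "\<rho> \<le> \<theta> * a"
  proof (cases "a \<le> b")
    case True
    then have "\<theta> = a / b" using ab by (simp add: \<theta>_def field_simps)
    then show ?thesis by (simp add: \<rho>_def power2_eq_square)
  next
    case False
    then have "\<theta> = 1" using ab by (simp add: \<theta>_def field_simps)
    then show ?thesis using False by (simp add: \<rho>_def)
  qed
  have LE: "3 / 4 * E t \<le> L t" "L t \<le> 5 / 4 * E t" for t
  proof -
    have 1: "\<bar>\<theta> * (p t \<bullet> q t)\<bar> \<le> 1 * \<bar>p t \<bullet> q t\<bar>"
      unfolding abs_mult using \<theta> by (intro mult_right_mono) auto
    have "0 \<le> (p t - q t) \<bullet> (p t - q t)" "0 \<le> (p t + q t) \<bullet> (p t + q t)" "0 \<le> v t \<bullet> v t"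
      by (rule inner_ge_zero)+
    then have "2 * \<bar>p t \<bullet> q t\<bar> \<le> E t"
      unfolding E_def inner_diff_left inner_diff_right inner_add_left inner_add_right
        inner_commute[of "q t" "p t"] by linarith
    with 1 have "\<bar>\<theta> * (p t \<bullet> q t)\<bar> \<le> E t / 2" by linarith
    then show "3 / 4 * E t \<le> L t" "L t \<le> 5 / 4 * E t"
      by (auto simp: L_def abs_le_iff)
  qed
  note ip = bounded_bilinear.has_vector_derivative[OF bounded_bilinear_inner]
  have "exp (\<rho> * t / 5) * L t \<le> exp (\<rho> * 0 / 5) * L 0"
  proof (rule DERIV_nonpos_imp_decreasing_open[OF t])
    show "continuous_on {0..t} (\<lambda>t. exp (\<rho> * t / 5) * L t)"
      unfolding L_def E_def
      by (intro continuous_intros) (auto intro: cont[THEN continuous_on_subset])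
  next
    fix x assume x: "0 < x" "x < t"
    define L' where "L' = 2 * (p x \<bullet> (b *\<^sub>R v x - a *\<^sub>R q x - a *\<^sub>R p x)) + 2 * (q x \<bullet> (a *\<^sub>R p x))
      + 2 * (v x \<bullet> (- b *\<^sub>R p x - b *\<^sub>R v x))
      + \<theta> / 2 * ((b *\<^sub>R v x - a *\<^sub>R q x - a *\<^sub>R p x) \<bullet> q x + p x \<bullet> (a *\<^sub>R p x))"
    have dL: "(L has_real_derivative L') (at x)"
      unfolding L_def E_def has_real_derivative_iff_has_vector_derivative
      by (rule derivative_eq_intros ip p q v refl | use x in simp; fail)+
         (simp add: L'_def inner_commute field_simps)
    have le: "L' \<le> - (\<rho> / 5) * L x"
      unfolding L'_def L_def E_def
      using energy_dissipation_inequality[OF ab \<theta> \<rho>' \<rho>(2,1), of "p x" "v x" "q x"] by simp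
    have "((\<lambda>t. exp (\<rho> * t / 5) * L t) has_real_derivative exp (\<rho> * x / 5) * (\<rho> / 5 * L x + L')) (at x)"
      by (auto intro!: derivative_eq_intros dL simp: algebra_simps)
    moreover have "exp (\<rho> * x / 5) * (\<rho> / 5 * L x + L') \<le> 0"
      using le by (intro mult_nonneg_nonpos) auto
    ultimately show "\<exists>y. ((\<lambda>t. exp (\<rho> * t / 5) * L t) has_real_derivative y) (at x) \<and> y \<le> 0" by blast
  qed
  then have "L t \<le> exp (- (\<rho> * t / 5)) * L 0"
    by (simp add: exp_minus field_simps)
  also have "\<dots> \<le> exp (- (\<rho> * t / 5)) * (5 / 4 * E 0)"
    using LE by (intro mult_left_mono) auto
  finally have "3 / 4 * E t \<le> exp (- (\<rho> * t / 5)) * (5 / 4 * E 0)" using LE(1)[of t] by linarith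
  then have "E t \<le> 5 / 3 * exp (- (\<rho> * t / 5)) * E 0" by simp
  then show ?thesis unfolding E_def power2_norm_eq_inner \<rho>_def .
qed

lemma norm_vec3_squared:
  fixes x :: "complex^3"
  shows "(norm x)\<^sup>2 = (norm (x$1))\<^sup>2 + (norm (x$2))\<^sup>2 + (norm (x$3))\<^sup>2"
  by (simp add: norm_vec_def L2_set_def sum_3)

text \<open>In the unknowns $p = (W_1 + W_2)/2$, $q = (W_1 - W_2)/(2i)$, $v = W_3$, which are the transforms of
  $u_t$, $(-\Delta)^{\sigma/2} u$ and $v$ in the second-order system behind the problem, the two
  matrices become real and the energy identity is visible.\<close>

lemma frequency_solution_decay:
  fixes W :: "real \<Rightarrow> complex^3" and a b :: real
  assumes ab: "0 < a" "0 < b"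
    and cont: "continuous_on {0..} W"
    and ode: "\<And>t. t > 0 \<Longrightarrow> (W has_vector_derivative (a *\<^sub>R D0 + b *\<^sub>R D1) *v W t) (at t)"
    and t: "0 \<le> t"
  shows "(norm (W t))\<^sup>2 \<le> 4 * exp (- (min b (a\<^sup>2 / b) * t / 5)) * (norm (W 0))\<^sup>2"
proof -
  define p where "p = (\<lambda>t. (W t $ 1 + W t $ 2) / 2)"
  define q where "q = (\<lambda>t. (W t $ 1 - W t $ 2) * (- \<i> / 2))"
  define v where "v = (\<lambda>t. W t $ 3)"
  define E where "E = (\<lambda>t. (norm (p t))\<^sup>2 + (norm (q t))\<^sup>2 + (norm (v t))\<^sup>2)"
  have W1: "((\<lambda>t. W t $ 1) has_vector_derivative
       a *\<^sub>R ((\<i> - 1/2) * W t $ 1 - 1/2 * W t $ 2) + b *\<^sub>R W t $ 3) (at t)"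
    and W2: "((\<lambda>t. W t $ 2) has_vector_derivative
       a *\<^sub>R (- 1/2 * W t $ 1 + (- \<i> - 1/2) * W t $ 2) + b *\<^sub>R W t $ 3) (at t)"
    and W3: "((\<lambda>t. W t $ 3) has_vector_derivative
       b *\<^sub>R (- 1/2 * W t $ 1 - 1/2 * W t $ 2 - W t $ 3)) (at t)" if "t > 0" for t
  proof -
    note comp = bounded_linear.has_vector_derivative[OF bounded_linear_vec_nth ode[OF that]]
    have D: "((a *\<^sub>R D0 + b *\<^sub>R D1) *v x) $ 1 = a *\<^sub>R ((\<i> - 1/2) * x $ 1 - 1/2 * x $ 2) + b *\<^sub>R x $ 3"
      "((a *\<^sub>R D0 + b *\<^sub>R D1) *v x) $ 2 = a *\<^sub>R (- 1/2 * x $ 1 + (- \<i> - 1/2) * x $ 2) + b *\<^sub>R x $ 3"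
      "((a *\<^sub>R D0 + b *\<^sub>R D1) *v x) $ 3 = b *\<^sub>R (- 1/2 * x $ 1 - 1/2 * x $ 2 - x $ 3)"
      for x :: "complex^3"
      by (simp_all add: matrix_vector_mult_def sum_3 D0_def D1_def vector_3 algebra_simps)
    show "((\<lambda>t. W t $ 1) has_vector_derivative
       a *\<^sub>R ((\<i> - 1/2) * W t $ 1 - 1/2 * W t $ 2) + b *\<^sub>R W t $ 3) (at t)"
      "((\<lambda>t. W t $ 2) has_vector_derivative
       a *\<^sub>R (- 1/2 * W t $ 1 + (- \<i> - 1/2) * W t $ 2) + b *\<^sub>R W t $ 3) (at t)"
      "((\<lambda>t. W t $ 3) has_vector_derivative
       b *\<^sub>R (- 1/2 * W t $ 1 - 1/2 * W t $ 2 - W t $ 3)) (at t)"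
      using comp[of 1] comp[of 2] comp[of 3] unfolding D .
  qed
  have "E t \<le> 5 / 3 * exp (- (min b (a\<^sup>2 / b) * t / 5)) * E 0"
    unfolding E_def
  proof (rule damped_system_energy_decay[OF ab _ _ _ _ _ _ t])
    show "continuous_on {0..} p" "continuous_on {0..} q" "continuous_on {0..} v"
      unfolding p_def q_def v_def by (intro continuous_intros cont; simp)+
  next
    fix t :: real assume t: "t > 0"
    show "(p has_vector_derivative b *\<^sub>R v t - a *\<^sub>R q t - a *\<^sub>R p t) (at t)"
      unfolding p_def
      by (rule derivative_eq_intros W1 W2 W3 t refl)+
         (simp add: p_def q_def v_def scaleR_conv_of_real field_simps)
    show "(q has_vector_derivative a *\<^sub>R p t) (at t)"
      unfolding q_def
      by (rule derivative_eq_intros W1 W2 W3 t refl)+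
         (simp add: p_def q_def v_def scaleR_conv_of_real field_simps)
    show "(v has_vector_derivative - b *\<^sub>R p t - b *\<^sub>R v t) (at t)"
      unfolding v_def
      by (rule has_vector_derivative_eq_rhs[OF W3[OF t]])
         (simp add: p_def q_def v_def scaleR_conv_of_real field_simps)
  qed
  \<comment> \<open>The parallelogram law turns the norm of $W$ into the energy, up to the weight of $v$.\<close>
  moreover have nE: "(norm (W t))\<^sup>2 = 2 * E t - (norm (v t))\<^sup>2" for t
  proof -
    have "(norm (x + y))\<^sup>2 + (norm (x - y))\<^sup>2 = 2 * (norm x)\<^sup>2 + 2 * (norm y)\<^sup>2" for x y :: complex
      unfolding cmod_power2 by (simp add: power2_eq_square algebra_simps)
    from this[of "W t $ 1" "W t $ 2"] have "(norm (W t $ 1))\<^sup>2 + (norm (W t $ 2))\<^sup>2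
        = ((norm (W t $ 1 + W t $ 2))\<^sup>2 + (norm (W t $ 1 - W t $ 2))\<^sup>2) / 2" by simp
    moreover have "(norm (p t))\<^sup>2 = (norm (W t $ 1 + W t $ 2))\<^sup>2 / 4"
        "(norm (q t))\<^sup>2 = (norm (W t $ 1 - W t $ 2))\<^sup>2 / 4"
      unfolding p_def q_def norm_mult norm_divide by (simp_all add: power_divide power_mult_distrib)
    ultimately show ?thesis
      by (simp add: norm_vec3_squared E_def v_def)
  qed
  have "(norm (W t))\<^sup>2 \<le> 2 * E t" using nE[of t] by simp
  moreover have "E 0 \<le> (norm (W 0))\<^sup>2" using nE[of 0] by (simp add: E_def)
  then have "5 / 3 * exp (- (min b (a\<^sup>2 / b) * t / 5)) * E 0
      \<le> 2 * exp (- (min b (a\<^sup>2 / b) * t / 5)) * (norm (W 0))\<^sup>2"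
    by (intro mult_mono) (auto simp: E_def)
  ultimately show ?thesis by linarith
qed

section \<open>The Fourier transform of integrable and square integrable functions\<close>

lemma norm_vector_scalar_mult:
  fixes c :: complex and v :: "complex^'m"
  shows "norm (c *s v) = norm c * norm v"
  by (simp add: norm_vec_def L2_set_def norm_mult power_mult_distrib real_sqrt_mult
      flip: sum_distrib_left)

lemma bounded_bilinear_vector_scalar_mult:
  "bounded_bilinear ((*s) :: complex \<Rightarrow> complex^'m \<Rightarrow> complex^'m)"
proof
  show "\<exists>K. \<forall>a b. norm (a *s (b :: complex^'m)) \<le> norm a * norm b * K"
    by (rule exI[of _ 1]) (simp add: norm_vector_scalar_mult)
qed (vector algebra_simps scaleR_conv_of_real)+

lemma borel_measurable_cis_mult:
  fixes f :: "real^'n \<Rightarrow> complex^'m"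
  assumes "f \<in> borel_measurable lebesgue"
  shows "(\<lambda>x. cis (- (x \<bullet> \<xi>)) *s f x) \<in> borel_measurable lebesgue"
proof (rule borel_measurable_continuous_Pair[where H = "(*s)", OF _ assms])
  show "(\<lambda>x. cis (- (x \<bullet> \<xi>))) \<in> borel_measurable lebesgue"
    by (intro measurable_completion borel_measurable_continuous_onI)
       (auto simp: cis_conv_exp intro!: continuous_intros)
  show "continuous_on UNIV (\<lambda>x. fst x *s (snd x :: complex^'m))"
    by (intro bounded_bilinear.continuous_on[OF bounded_bilinear_vector_scalar_mult] continuous_intros)
qed

lemma integrable_cis_mult:
  fixes f :: "real^'n \<Rightarrow> complex^'m"
  assumes "integrable lebesgue f"
  shows "integrable lebesgue (\<lambda>x. cis (- (x \<bullet> \<xi>)) *s f x)"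
  by (rule Bochner_Integration.integrable_bound[OF assms])
     (use assms in \<open>auto simp: norm_vector_scalar_mult intro!: borel_measurable_cis_mult\<close>)

text \<open>Continuity is used only to know that transforms are measurable, so that the integrals
  defining convergence in mean square are additive.\<close>

lemma continuous_fourier_L1:
  fixes f :: "real^'n \<Rightarrow> complex^'m"
  assumes f: "integrable lebesgue f"
  shows "continuous_on UNIV (fourier_L1 f)"
proof -
  have "(\<lambda>k. LINT x|lebesgue. cis (- (x \<bullet> X k)) *s f x) \<longlonglongrightarrow> (LINT x|lebesgue. cis (- (x \<bullet> \<xi>)) *s f x)"
    if "X \<longlonglongrightarrow> \<xi>" for X \<xi>
  proof (rule integral_dominated_convergence[where w = "\<lambda>x. norm (f x)"])
    show "AE x in lebesgue. (\<lambda>k. cis (- (x \<bullet> X k)) *s f x) \<longlonglongrightarrow> cis (- (x \<bullet> \<xi>)) *s f x"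
      using that
      by (auto simp: cis_conv_exp intro!: bounded_bilinear.tendsto[OF bounded_bilinear_vector_scalar_mult] tendsto_intros)
  qed (use f in \<open>auto simp: norm_vector_scalar_mult intro!: borel_measurable_cis_mult\<close>)
  then show ?thesis
    unfolding fourier_L1_def
    by (intro continuous_intros) (auto simp: continuous_on_eq_continuous_at continuous_at_sequentially o_def)
qed

lemma measurable_fourier_L1:
  fixes f :: "real^'n \<Rightarrow> complex^'m"
  assumes "integrable lebesgue f"
  shows "fourier_L1 f \<in> borel_measurable lebesgue"
  by (intro measurable_completion) (use continuous_fourier_L1[OF assms] in \<open>auto intro: borel_measurable_continuous_onI\<close>)

text \<open>On a ball, $|f| \le 1 + |f|^2$ and constants are integrable.\<close>

lemma truncation_integrable:
  fixes f :: "real^'n \<Rightarrow> complex^'m"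
  assumes "f \<in> L2"
  shows "integrable lebesgue (\<lambda>x. indicator (cball 0 R) x *\<^sub>R f x)"
proof (rule Bochner_Integration.integrable_bound)
  have f: "f \<in> borel_measurable lebesgue" "integrable lebesgue (\<lambda>x. (norm (f x))\<^sup>2)"
    using assms by (auto simp: L2_def)
  have "emeasure lebesgue (cball 0 R :: (real^'n) set) < \<infinity>"
    using emeasure_bounded_finite[OF bounded_cball, of "0 :: real^'n" R] by simp
  then show "integrable lebesgue (\<lambda>x. indicator (cball 0 R) x + (norm (f x))\<^sup>2)"
    using f by (intro Bochner_Integration.integrable_add) (auto intro!: integrable_real_indicator)
  show "(\<lambda>x. indicator (cball 0 R) x *\<^sub>R f x) \<in> borel_measurable lebesgue"
    using f by (intro borel_measurable_scaleR borel_measurable_indicator) auto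
  have "r \<le> 1 + r\<^sup>2" for r :: real
    using zero_le_power2[of "r - 1/2"] by (simp add: power2_eq_square algebra_simps)
  then show "AE x in lebesgue. norm (indicator (cball 0 R) x *\<^sub>R f x) \<le> norm (indicator (cball 0 R) x + (norm (f x))\<^sup>2)"
    by (auto simp: indicator_def)
qed

lemma truncated_fourier_measurable [measurable]:
  fixes f :: "real^'n \<Rightarrow> complex^'m"
  assumes "f \<in> L2"
  shows "fourier_L1 (\<lambda>x. indicator (cball 0 R) x *\<^sub>R f x) \<in> borel_measurable lebesgue"
  by (rule measurable_fourier_L1[OF truncation_integrable[OF assms]])

lemma has_fourier_L2_sequentially:
  assumes "has_fourier_L2 f g"
  shows "(\<lambda>k. \<integral>\<^sup>+\<xi>. ennreal ((norm (fourier_L1 (\<lambda>x. indicator (cball 0 (real k)) x *\<^sub>R f x) \<xi> - g \<xi>))\<^sup>2)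
        \<partial>lebesgue) \<longlonglongrightarrow> 0"
  using filterlim_compose[OF _ filterlim_real_sequentially] assms
  unfolding has_fourier_L2_def by blast

lemma norm_diff_squared_le:
  fixes x y z :: "'a::real_normed_vector"
  shows "(norm (x - y))\<^sup>2 \<le> 2 * (norm (z - x))\<^sup>2 + 2 * (norm (z - y))\<^sup>2"
proof -
  have "norm (x - y) \<le> norm (z - x) + norm (z - y)"
    by (metis norm_minus_commute norm_triangle_sub diff_add_cancel add.commute norm_diff_triangle_le order_refl)
  then have "(norm (x - y))\<^sup>2 \<le> (norm (z - x) + norm (z - y))\<^sup>2" by (intro power_mono) auto
  also have "\<dots> \<le> 2 * (norm (z - x))\<^sup>2 + 2 * (norm (z - y))\<^sup>2"
    using sum_squares_bound[of "norm (z - x)" "norm (z - y)"] by (simp add: power2_sum)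
  finally show ?thesis .
qed

text \<open>Both $g$ and $h$ are limits in mean square of the same transforms of truncations. This is what
  makes statements about the chosen representative \<^const>\<open>fourier_L2\<close> independent of the choice.\<close>

lemma has_fourier_L2_unique:
  fixes f g h :: "real^'n \<Rightarrow> complex^'m"
  assumes g: "has_fourier_L2 f g" and h: "has_fourier_L2 f h"
  shows "AE \<xi> in lebesgue. g \<xi> = h \<xi>"
proof -
  let ?F = "\<lambda>k::nat. fourier_L1 (\<lambda>x. indicator (cball 0 (real k)) x *\<^sub>R f x)"
  have f: "f \<in> L2" and [measurable]: "g \<in> borel_measurable lebesgue" "h \<in> borel_measurable lebesgue"
    using g h by (auto simp: has_fourier_L2_def L2_def)
  note [measurable] = truncated_fourier_measurable[OF f]
  have le: "(\<integral>\<^sup>+\<xi>. ennreal ((norm (g \<xi> - h \<xi>))\<^sup>2) \<partial>lebesgue)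
      \<le> 2 * (\<integral>\<^sup>+\<xi>. ennreal ((norm (?F k \<xi> - g \<xi>))\<^sup>2) \<partial>lebesgue)
        + 2 * (\<integral>\<^sup>+\<xi>. ennreal ((norm (?F k \<xi> - h \<xi>))\<^sup>2) \<partial>lebesgue)" for k
  proof -
    have "(\<integral>\<^sup>+\<xi>. ennreal ((norm (g \<xi> - h \<xi>))\<^sup>2) \<partial>lebesgue)
      \<le> (\<integral>\<^sup>+\<xi>. 2 * ennreal ((norm (?F k \<xi> - g \<xi>))\<^sup>2) + 2 * ennreal ((norm (?F k \<xi> - h \<xi>))\<^sup>2) \<partial>lebesgue)"
      using norm_diff_squared_le
      by (intro nn_integral_mono)
         (simp flip: ennreal_numeral ennreal_mult ennreal_plus add: ennreal_leI del: ennreal_plus)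
    also have "\<dots> = 2 * (\<integral>\<^sup>+\<xi>. ennreal ((norm (?F k \<xi> - g \<xi>))\<^sup>2) \<partial>lebesgue)
        + 2 * (\<integral>\<^sup>+\<xi>. ennreal ((norm (?F k \<xi> - h \<xi>))\<^sup>2) \<partial>lebesgue)"
      by (subst nn_integral_add) (auto simp: nn_integral_cmult)
    finally show ?thesis .
  qed
  have "(\<lambda>k. 2 * (\<integral>\<^sup>+\<xi>. ennreal ((norm (?F k \<xi> - g \<xi>))\<^sup>2) \<partial>lebesgue)
        + 2 * (\<integral>\<^sup>+\<xi>. ennreal ((norm (?F k \<xi> - h \<xi>))\<^sup>2) \<partial>lebesgue)) \<longlonglongrightarrow> 2 * 0 + 2 * 0"
    by (intro tendsto_add ennreal_tendsto_cmult has_fourier_L2_sequentially g h) auto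
  then have "(\<integral>\<^sup>+\<xi>. ennreal ((norm (g \<xi> - h \<xi>))\<^sup>2) \<partial>lebesgue) \<le> 0"
    using le by (intro LIMSEQ_le_const) auto
  then show ?thesis
    by (simp add: nn_integral_0_iff_AE)
qed

lemma has_fourier_L2_fourier_L2: "has_fourier_L2 f g \<Longrightarrow> has_fourier_L2 f (fourier_L2 f)"
  unfolding fourier_L2_def by (rule someI[of "has_fourier_L2 f"])

text \<open>For integrable $f$ the transforms of the truncations also converge pointwise to the transform of
  $f$, by dominated convergence. Fatou's lemma then bounds the mean square distance between the two
  limits by $0$.\<close>

lemma fourier_L2_eq_fourier_L1:
  fixes f g :: "real^'n \<Rightarrow> complex^'m"
  assumes g: "has_fourier_L2 f g" and int: "integrable lebesgue f"
  shows "AE \<xi> in lebesgue. g \<xi> = fourier_L1 f \<xi>"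
proof -
  let ?F = "\<lambda>k::nat. fourier_L1 (\<lambda>x. indicator (cball 0 (real k)) x *\<^sub>R f x)"
  have f: "f \<in> L2" and [measurable]: "g \<in> borel_measurable lebesgue"
    using g by (auto simp: has_fourier_L2_def L2_def)
  note [measurable] = truncated_fourier_measurable[OF f] measurable_fourier_L1[OF int]
  have lim: "(\<lambda>k. ?F k \<xi>) \<longlonglongrightarrow> fourier_L1 f \<xi>" for \<xi>
    unfolding fourier_L1_def
  proof (intro tendsto_scaleR tendsto_const integral_dominated_convergence[where w = "\<lambda>x. norm (f x)"])
    show "AE x in lebesgue. (\<lambda>k. cis (- (x \<bullet> \<xi>)) *s indicator (cball 0 (real k)) x *\<^sub>R f x) \<longlonglongrightarrow> cis (- (x \<bullet> \<xi>)) *s f x"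
    proof (rule AE_I2, rule tendsto_eventually)
      fix x :: "real^'n"
      show "\<forall>\<^sub>F k in sequentially. cis (- (x \<bullet> \<xi>)) *s indicator (cball 0 (real k)) x *\<^sub>R f x = cis (- (x \<bullet> \<xi>)) *s f x"
        using eventually_ge_at_top[of "nat \<lceil>norm x\<rceil>"]
        by eventually_elim (auto simp: indicator_def nat_le_iff ceiling_le_iff)
    qed
    show "AE x in lebesgue. norm (cis (- (x \<bullet> \<xi>)) *s indicator (cball 0 (real k)) x *\<^sub>R f x) \<le> norm (f x)" for k
      by (auto simp: norm_vector_scalar_mult indicator_def)
  qed (use int in \<open>auto intro!: borel_measurable_cis_mult borel_measurable_scaleR borel_measurable_indicator\<close>)
  have "(\<integral>\<^sup>+\<xi>. ennreal ((norm (fourier_L1 f \<xi> - g \<xi>))\<^sup>2) \<partial>lebesgue)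
     = (\<integral>\<^sup>+\<xi>. liminf (\<lambda>k. ennreal ((norm (?F k \<xi> - g \<xi>))\<^sup>2)) \<partial>lebesgue)"
    by (intro nn_integral_cong lim_imp_Liminf[symmetric] tendsto_ennrealI tendsto_intros lim) auto
  also have "\<dots> \<le> liminf (\<lambda>k. \<integral>\<^sup>+\<xi>. ennreal ((norm (?F k \<xi> - g \<xi>))\<^sup>2) \<partial>lebesgue)"
    by (intro nn_integral_liminf) auto
  also have "\<dots> = 0"
    by (intro lim_imp_Liminf has_fourier_L2_sequentially g) auto
  finally have "AE \<xi> in lebesgue. fourier_L1 f \<xi> = g \<xi>"
    by (simp add: nn_integral_0_iff_AE)
  then show ?thesis by eventually_elim simp
qed

text \<open>Interpolation between the Lipschitz bound $|y|$ and the trivial bound $2$.\<close>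

lemma norm_cis_diff_one_le:
  fixes y \<kappa> :: real
  assumes "0 \<le> \<kappa>" "\<kappa> \<le> 1"
  shows "norm (cis y - 1) \<le> 2 * \<bar>y\<bar> powr \<kappa>"
proof (cases "\<bar>y\<bar> \<le> 1")
  case True
  have "norm (cis y - 1) \<le> \<bar>y\<bar>"
    using dist_exp_i_1[of y] abs_sin_x_le_abs_x[of "y / 2"] by (simp add: cis_conv_exp)
  also have "\<dots> \<le> \<bar>y\<bar> powr \<kappa>"
    using powr_mono'[of \<kappa> 1 "\<bar>y\<bar>"] True assms by simp
  also have "\<dots> \<le> 2 * \<bar>y\<bar> powr \<kappa>" by simp
  finally show ?thesis .
next
  case False
  have "norm (cis y - 1) \<le> norm (cis y) + norm (1::complex)" by (rule norm_triangle_ineq4)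
  then have "norm (cis y - 1) \<le> 2 * 1" by simp
  also have "\<dots> \<le> 2 * \<bar>y\<bar> powr \<kappa>"
    using False assms by (intro mult_left_mono ge_one_powr_ge_zero) auto
  finally show ?thesis .
qed

text \<open>The transform at the origin is a multiple of the total mass. The weight $(1 + |x|)^\kappa$ controls
  the Hoelder modulus of order $\kappa$ of the transform there, so the remainder
  after splitting off the mass gains a factor $|\xi|^\kappa$, which becomes additional decay in time. The
  origin itself is excluded because \<open>0 powr 0 = 0\<close>.\<close>

lemma norm_fourier_L1_le:
  fixes f :: "real^'n \<Rightarrow> complex^'m" and \<kappa> :: real
  assumes \<kappa>: "0 \<le> \<kappa>" "\<kappa> \<le> 1" and f: "f \<in> weighted_L1 \<kappa>" and \<xi>: "\<xi> \<noteq> 0"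
  shows "norm (fourier_L1 f \<xi>) \<le> norm (total_mass f) + 2 * norm \<xi> powr \<kappa> * weighted_L1_norm \<kappa> f"
proof -
  have int: "integrable lebesgue f" "integrable lebesgue (\<lambda>x. (1 + norm x) powr \<kappa> * norm (f x))"
    using f by (auto simp: weighted_L1_def)
  let ?I = "LINT x|lebesgue. cis (- (x \<bullet> \<xi>)) *s f x"
  have "?I - total_mass f = (LINT x|lebesgue. (cis (- (x \<bullet> \<xi>)) - 1) *s f x)"
    unfolding total_mass_def using int
    by (subst Bochner_Integration.integral_diff[symmetric])
       (auto intro!: integrable_cis_mult Bochner_Integration.integral_cong simp: vec_eq_iff algebra_simps)
  also have "norm \<dots> \<le> (LINT x|lebesgue. 2 * norm \<xi> powr \<kappa> * ((1 + norm x) powr \<kappa> * norm (f x)))"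
  proof (rule Bochner_Integration.integral_norm_bound_integral)
    have "integrable lebesgue (\<lambda>x. cis (- (x \<bullet> \<xi>)) *s f x - f x)"
      using int by (intro Bochner_Integration.integrable_diff integrable_cis_mult)
    then show "integrable lebesgue (\<lambda>x. (cis (- (x \<bullet> \<xi>)) - 1) *s f x)"
      by (rule Bochner_Integration.integrable_cong[THEN iffD1, rotated 2]) (auto simp: vec_eq_iff algebra_simps)
    show "norm ((cis (- (x \<bullet> \<xi>)) - 1) *s f x) \<le> 2 * norm \<xi> powr \<kappa> * ((1 + norm x) powr \<kappa> * norm (f x))" for x
    proof -
      have "norm (cis (- (x \<bullet> \<xi>)) - 1) \<le> 2 * \<bar>x \<bullet> \<xi>\<bar> powr \<kappa>"
        using norm_cis_diff_one_le[OF \<kappa>, of "- (x \<bullet> \<xi>)"] by simp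
      also have "\<bar>x \<bullet> \<xi>\<bar> \<le> (1 + norm x) * norm \<xi>"
        using Cauchy_Schwarz_ineq2[of x \<xi>] mult_right_mono[of "norm x" "1 + norm x" "norm \<xi>"] by simp
      then have "2 * \<bar>x \<bullet> \<xi>\<bar> powr \<kappa> \<le> 2 * ((1 + norm x) * norm \<xi>) powr \<kappa>"
        using \<kappa> by (intro mult_left_mono powr_mono2) auto
      also have "\<dots> = 2 * norm \<xi> powr \<kappa> * (1 + norm x) powr \<kappa>"
        by (simp add: powr_mult)
      finally show ?thesis
        unfolding norm_vector_scalar_mult by (metis mult.assoc mult_right_mono norm_ge_zero)
    qed
  qed (use int in auto)
  also have "\<dots> = 2 * norm \<xi> powr \<kappa> * weighted_L1_norm \<kappa> f"
    by (simp add: weighted_L1_norm_def)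
  finally have "norm ?I \<le> norm (total_mass f) + 2 * norm \<xi> powr \<kappa> * weighted_L1_norm \<kappa> f"
    using norm_triangle_sub[of ?I "total_mass f"] by linarith
  \<comment> \<open>The normalising factor is at most $1$ and is dropped.\<close>
  moreover have "(2 * pi) powr (- real CARD('n) / 2) \<le> (2 * pi) powr 0"
    using pi_ge_two by (intro powr_mono) auto
  then have "norm (fourier_L1 f \<xi>) \<le> 1 * norm ?I"
    unfolding fourier_L1_def norm_scaleR by (intro mult_right_mono) auto
  ultimately show ?thesis by simp
qed

section \<open>Integrals of stretched exponentials\<close>

text \<open>The exponential series dominates its term of order \<open>k\<close>.\<close>

lemma power_exp_neg_bounded:
  fixes d :: real
  assumes d: "d > 0"
  shows "\<exists>C>0. \<forall>x\<ge>0. x ^ k * exp (- d * x) \<le> C"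
proof (intro exI conjI allI impI)
  let ?C = "fact k / d ^ k :: real"
  show "0 < ?C" using d by simp
  fix x :: real assume x: "0 \<le> x"
  have "(d * x) ^ k / fact k = (\<Sum>n\<in>{k}. (d * x) ^ n /\<^sub>R fact n)" by (simp add: field_simps)
  also have "\<dots> \<le> (\<Sum>n. (d * x) ^ n /\<^sub>R fact n)"
    using d x by (intro sum_le_suminf summable_exp_generic) auto
  also have "\<dots> = exp (d * x)" by (simp add: exp_def)
  finally show "x ^ k * exp (- d * x) \<le> ?C"
    using d by (simp add: exp_minus field_simps power_mult_distrib)
qed

text \<open>Since $\beta \ge 1$, $r^\beta \ge r - 1$, which reduces the decay to that of $e^{-dr}$; this beats
  any polynomial.\<close>

lemma stretched_exp_weight_bound:
  fixes m \<beta> d :: real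
  assumes m: "0 \<le> m" and \<beta>: "1 \<le> \<beta>" and d: "0 < d"
  shows "\<exists>C>0. \<forall>r\<ge>0. r powr m * exp (- d * r powr \<beta>) \<le> C / (1 + r) ^ N"
proof -
  define k where "k = nat \<lceil>m\<rceil>"
  obtain C where C: "C > 0" "\<And>x. x \<ge> 0 \<Longrightarrow> x ^ (k + N) * exp (- d * x) \<le> C"
    using power_exp_neg_bounded[OF d] by blast
  have "r powr m * exp (- d * r powr \<beta>) \<le> (exp (2 * d) * C) / (1 + r) ^ N" if r: "r \<ge> 0" for r
  proof -
    have "r powr m \<le> (1 + r) powr m" using r m by (intro powr_mono2) auto
    also have "\<dots> \<le> (1 + r) powr real k" using r m by (intro powr_mono) (auto simp: k_def)
    also have "\<dots> = (1 + r) ^ k" using r by (simp add: powr_realpow)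
    finally have 1: "r powr m \<le> (1 + r) ^ k" .
    have "r - 1 \<le> r powr \<beta>"
    proof (cases "r \<le> 1")
      case False
      then show ?thesis using powr_mono[of 1 \<beta> r] \<beta> by simp
    qed (use powr_ge_zero[of r \<beta>] in linarith)
    then have "- d * r powr \<beta> \<le> - d * (r - 1)" using d by simp
    then have "exp (- d * r powr \<beta>) \<le> exp (2 * d) * exp (- d * (1 + r))"
      unfolding exp_add[symmetric] by (simp add: algebra_simps)
    then have "r powr m * exp (- d * r powr \<beta>) \<le> (1 + r) ^ k * (exp (2 * d) * exp (- d * (1 + r)))"
      using 1 r by (intro mult_mono) auto
    then have "r powr m * exp (- d * r powr \<beta>) * (1 + r) ^ N
        \<le> (1 + r) ^ k * (exp (2 * d) * exp (- d * (1 + r))) * (1 + r) ^ N"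
      using r by (intro mult_right_mono) auto
    also have "\<dots> = exp (2 * d) * ((1 + r) ^ (k + N) * exp (- d * (1 + r)))"
      by (simp add: power_add)
    also have "\<dots> \<le> exp (2 * d) * C" using C(2)[of "1 + r"] r by (intro mult_left_mono) auto
    finally show ?thesis using r by (simp add: field_simps)
  qed
  moreover have "exp (2 * d) * C > 0" using C by simp
  ultimately show ?thesis by blast
qed

text \<open>This is the scaling $\xi = T^{-1/\beta}\eta$: the power of $T$ collects $T^{-n/\beta}$ from the
  volume element and $T^{-m/\beta}$ from the factor $|\xi|^m$. The
  integrand is dominated by a series of indicators of the balls of radius $(k+1)R$ with
  $R = T^{-1/\beta}$, whose volumes are explicit. The decay of order $n + 2$ in the shell index pays
  for the volume $(k+1)^n$ and leaves the convergent series $\sum_k (k+1)^{-2}$.\<close>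

lemma nn_integral_stretched_exp_le:
  fixes m \<beta> d :: real
  assumes m: "0 \<le> m" and \<beta>: "1 \<le> \<beta>" and d: "0 < d"
  shows "\<exists>C>0. \<forall>T>0. (\<integral>\<^sup>+x. ennreal (norm x powr m * exp (- d * (T * norm x powr \<beta>))) \<partial>(lborel :: 'a::euclidean_space measure))
    \<le> ennreal (C * T powr (- (real DIM('a) + m) / \<beta>))"
proof -
  let ?n = "DIM('a)"
  obtain C where C: "C > 0" "\<And>r. r \<ge> 0 \<Longrightarrow> r powr m * exp (- d * r powr \<beta>) \<le> C / (1 + r) ^ (?n + 2)"
    using stretched_exp_weight_bound[OF assms] by blast
  define V where "V = unit_ball_vol (real ?n)"
  have V: "V > 0" by (simp add: V_def)
  have sum: "summable (\<lambda>k. 1 / (real k + 1)\<^sup>2)"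
    using inverse_squares_sums sums_summable by (auto simp: add.commute)
  define S where "S = (\<Sum>k. 1 / (real k + 1)\<^sup>2)"
  have S: "S > 0" unfolding S_def by (intro suminf_pos sum) (auto simp: field_simps)
  have "(\<integral>\<^sup>+x. ennreal (norm x powr m * exp (- d * (T * norm x powr \<beta>))) \<partial>(lborel :: 'a measure))
    \<le> ennreal (V * C * S * T powr (- (real ?n + m) / \<beta>))" if T: "T > 0" for T
  proof -
    define R where "R = T powr (- 1 / \<beta>)"
    have R: "R > 0" using T by (simp add: R_def)
    have "R powr \<beta> = T powr - 1" using \<beta> unfolding R_def powr_powr by simp
    then have RT: "T * R powr \<beta> = 1" using T by (simp add: powr_minus)
    define c where "c = (\<lambda>k::nat. C * R powr m / (real k + 1) ^ (?n + 2))"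
    have c: "c k \<ge> 0" for k using C R by (simp add: c_def)
    have "(\<integral>\<^sup>+x. ennreal (norm x powr m * exp (- d * (T * norm x powr \<beta>))) \<partial>(lborel :: 'a measure))
      \<le> (\<integral>\<^sup>+x. (\<Sum>k. ennreal (c k) * indicator (cball 0 ((real k + 1) * R)) x) \<partial>(lborel :: 'a measure))"
    proof (rule nn_integral_mono)
      fix x :: 'a
      define r where "r = norm x / R"
      define k where "k = nat \<lfloor>r\<rfloor>"
      have r: "r \<ge> 0" "norm x = r * R" using R by (auto simp: r_def)
      have k: "real k \<le> r" "r \<le> real k + 1" using r unfolding k_def by linarith+
      have "norm x powr m * exp (- d * (T * norm x powr \<beta>)) = R powr m * (r powr m * exp (- d * (r powr \<beta> * (T * R powr \<beta>))))"
        using r R by (simp add: powr_mult mult_ac)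
      also have "\<dots> \<le> R powr m * (C / (1 + r) ^ (?n + 2))"
        using C(2)[OF r(1)] unfolding RT by (intro mult_left_mono) auto
      also have "\<dots> \<le> R powr m * (C / (real k + 1) ^ (?n + 2))"
        using C(1) r k by (intro mult_left_mono divide_left_mono power_mono mult_pos_pos) auto
      also have "\<dots> = c k" by (simp add: c_def)
      finally have "ennreal (norm x powr m * exp (- d * (T * norm x powr \<beta>))) \<le> ennreal (c k)" by (rule ennreal_leI)
      also have "\<dots> = ennreal (c k) * indicator (cball 0 ((real k + 1) * R)) x"
        using k R r by (simp add: indicator_def)
      also have "\<dots> = (\<Sum>i\<in>{k}. ennreal (c i) * indicator (cball 0 ((real i + 1) * R)) x)"
        by (subst sum.insert) (simp_all only: finite.emptyI empty_iff not_False_eq_True sum.empty add_0_right)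
      also have "\<dots> \<le> (\<Sum>k. ennreal (c k) * indicator (cball 0 ((real k + 1) * R)) x)"
        by (intro sum_le_suminf) auto
      finally show "ennreal (norm x powr m * exp (- d * (T * norm x powr \<beta>)))
        \<le> (\<Sum>k. ennreal (c k) * indicator (cball 0 ((real k + 1) * R)) x)" .
    qed
    also have "\<dots> = (\<Sum>k. ennreal (c k) * emeasure lborel (cball 0 ((real k + 1) * R) :: 'a set))"
      by (subst nn_integral_suminf)
         (auto simp: nn_integral_cmult_indicator intro!: borel_measurable_times_ennreal borel_measurable_indicator)
    also have "\<dots> = (\<Sum>k. ennreal (V * C * R powr (real ?n + m) * (1 / (real k + 1)\<^sup>2)))"
    proof (rule suminf_cong)
      fix k
      have "ennreal (c k) * emeasure lborel (cball 0 ((real k + 1) * R) :: 'a set)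
        = ennreal (c k * (V * ((real k + 1) * R) ^ ?n))"
        using R c V by (subst emeasure_cball) (auto simp: V_def ennreal_mult)
      also have "c k * (V * ((real k + 1) * R) ^ ?n) = V * C * R powr (real ?n + m) * (1 / (real k + 1)\<^sup>2)"
      proof -
        have "C * R powr m / u ^ (?n + 2) * (V * (u * R) ^ ?n) = V * C * R powr (real ?n + m) * (1 / u\<^sup>2)"
          if "u > 0" for u
          using R that by (simp add: power_mult_distrib powr_add powr_realpow power_add
                power2_eq_square)
        from this[of "real k + 1"] show ?thesis by (simp add: c_def)
      qed
      finally show "ennreal (c k) * emeasure lborel (cball 0 ((real k + 1) * R) :: 'a set)
        = ennreal (V * C * R powr (real ?n + m) * (1 / (real k + 1)\<^sup>2))" .
    qed
    also have "\<dots> = ennreal (V * C * R powr (real ?n + m) * S)"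
      unfolding S_def suminf_mult[OF sum, symmetric]
      using V C sum by (intro suminf_ennreal2 summable_mult) auto
    also have "R powr (real ?n + m) = T powr (- (real ?n + m) / \<beta>)"
      unfolding R_def powr_powr
      by (rule arg_cong[where f = "(powr) T"]) (simp add: add_divide_distrib diff_divide_distrib)
    finally show ?thesis by (simp add: mult_ac)
  qed
  moreover have "V * C * S > 0" using V C S by simp
  ultimately show ?thesis by blast
qed

section \<open>Homogeneous and inhomogeneous Sobolev norms\<close>

lemma L2_norm_squared:
  fixes f :: "real^'n \<Rightarrow> complex^'m"
  assumes "f \<in> L2"
  shows "ennreal ((L2_norm f)\<^sup>2) = (\<integral>\<^sup>+\<xi>. ennreal ((norm (f \<xi>))\<^sup>2) \<partial>lebesgue)"
  using assms by (simp add: L2_def L2_norm_def nn_integral_eq_integral)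

lemma L2_dominated:
  fixes f :: "real^'n \<Rightarrow> complex^'m" and g :: "real^'n \<Rightarrow> complex^'k"
  assumes f: "f \<in> borel_measurable lebesgue" and g: "g \<in> L2" and c: "0 \<le> c"
    and le: "AE \<xi> in lebesgue. norm (f \<xi>) \<le> c * norm (g \<xi>)"
  shows "f \<in> L2"
proof -
  have "integrable lebesgue (\<lambda>\<xi>. (norm (f \<xi>))\<^sup>2)"
  proof (rule Bochner_Integration.integrable_bound)
    show "integrable lebesgue (\<lambda>\<xi>. c\<^sup>2 * (norm (g \<xi>))\<^sup>2)" using g by (simp add: L2_def)
    show "(\<lambda>\<xi>. (norm (f \<xi>))\<^sup>2) \<in> borel_measurable lebesgue" using f by simp
    show "AE \<xi> in lebesgue. norm ((norm (f \<xi>))\<^sup>2) \<le> norm (c\<^sup>2 * (norm (g \<xi>))\<^sup>2)"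
      using le
    proof eventually_elim
      case (elim \<xi>)
      then have "(norm (f \<xi>))\<^sup>2 \<le> (c * norm (g \<xi>))\<^sup>2" by (intro power_mono) auto
      then show ?case by (simp add: power_mult_distrib)
    qed
  qed
  with f show ?thesis by (simp add: L2_def)
qed

lemma nn_integral_combination_of_three:
  fixes a b c :: ennreal
  assumes "f \<in> borel_measurable M" "g \<in> borel_measurable M" "h \<in> borel_measurable M"
  shows "(\<integral>\<^sup>+x. a * f x + b * g x + c * h x \<partial>M)
    = a * integral\<^sup>N M f + b * integral\<^sup>N M g + c * integral\<^sup>N M h"
  using assms by (simp add: nn_integral_add nn_integral_cmult)

lemma laplacian_symbol_nonzero: "\<xi> \<noteq> 0 \<Longrightarrow> laplacian_symbol \<nu> \<xi> = norm \<xi> powr (2 * \<nu>)"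
  by (simp add: laplacian_symbol_def)

lemma laplacian_symbol_nonneg: "0 \<le> laplacian_symbol \<nu> \<xi>"
  by (simp add: laplacian_symbol_def)

text \<open>This lets the Bessel norm of the data control the high frequencies of the solution.\<close>

lemma laplacian_symbol_le_bessel_weight:
  fixes \<xi> :: "real^'n"
  assumes "0 \<le> s"
  shows "laplacian_symbol (s / 2) \<xi> \<le> (1 + (norm \<xi>)\<^sup>2) powr (s / 2)"
proof (cases "s = 0 \<or> \<xi> = 0")
  case True
  have "0 < 1 + (norm \<xi>)\<^sup>2" by (simp add: add_pos_nonneg)
  with True show ?thesis by (auto simp: laplacian_symbol_def)
next
  case False
  then have "laplacian_symbol (s / 2) \<xi> = ((norm \<xi>) powr 2) powr (s / 2)"
    unfolding powr_powr by (simp add: laplacian_symbol_def)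
  also have "\<dots> = ((norm \<xi>)\<^sup>2) powr (s / 2)" using False by (simp add: powr_numeral)
  also have "\<dots> \<le> (1 + (norm \<xi>)\<^sup>2) powr (s / 2)" using assms by (intro powr_mono2) auto
  finally show ?thesis .
qed

lemma borel_measurable_laplacian_symbol [measurable]:
  "laplacian_symbol \<nu> \<in> borel_measurable (lebesgue :: (real^'n) measure)"
  unfolding laplacian_symbol_def by (cases "\<nu> = 0") (auto intro!: measurable_completion)

lemma borel_measurable_bessel_weight [measurable]:
  "(\<lambda>\<xi>. (1 + (norm \<xi>)\<^sup>2) powr \<nu>) \<in> borel_measurable (lebesgue :: (real^'n) measure)"
  by (auto intro!: measurable_completion)

lemma bessel_space_mono:
  fixes f :: "real^'n \<Rightarrow> complex^'m"
  assumes f: "f \<in> bessel_space s" and s: "s' \<le> s"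
  shows "f \<in> bessel_space s'"
proof -
  obtain g where g: "has_fourier_L2 f g" using f by (auto simp: bessel_space_def)
  then have [measurable]: "fourier_L2 f \<in> borel_measurable lebesgue"
    using has_fourier_L2_fourier_L2[OF g] by (auto simp: has_fourier_L2_def L2_def)
  have "(\<lambda>\<xi>. (1 + (norm \<xi>)\<^sup>2) powr (s' / 2) *\<^sub>R fourier_L2 f \<xi>) \<in> L2"
  proof (rule L2_dominated[where c = 1])
    show "(\<lambda>\<xi>. (1 + (norm \<xi>)\<^sup>2) powr (s / 2) *\<^sub>R fourier_L2 f \<xi>) \<in> L2"
      using f by (simp add: bessel_space_def)
    show "AE \<xi> in lebesgue. norm ((1 + (norm \<xi>)\<^sup>2) powr (s' / 2) *\<^sub>R fourier_L2 f \<xi>)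
        \<le> 1 * norm ((1 + (norm \<xi>)\<^sup>2) powr (s / 2) *\<^sub>R fourier_L2 f \<xi>)"
      using s by (auto intro!: mult_right_mono powr_mono)
  qed auto
  with g show ?thesis by (auto simp: bessel_space_def)
qed

section \<open>Decay of the solution\<close>

text \<open>With $a = r^\sigma$ and $b = r^{2\sigma\alpha}$ the rate $\min(b, a^2/b)$ is the minimum of two powers
  of $r$. The larger exponent decides for $r \le 1$; for $r \ge 1$ the rate is at least $1$, so high
  frequencies decay exponentially without loss of regularity.\<close>

lemma decay_rate_lower_bound:
  fixes \<sigma> \<alpha> r :: real
  assumes \<sigma>: "0 \<le> \<sigma>" and \<alpha>: "0 \<le> \<alpha>" "\<alpha> \<le> 1" and r: "0 < r"
  shows "min 1 (r powr max (2 * \<sigma> * \<alpha>) (2 * \<sigma> - 2 * \<sigma> * \<alpha>))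
    \<le> min (r powr (2 * \<sigma> * \<alpha>)) ((r powr \<sigma>)\<^sup>2 / r powr (2 * \<sigma> * \<alpha>))"
proof -
  have eq: "(r powr \<sigma>)\<^sup>2 / r powr (2 * \<sigma> * \<alpha>) = r powr (2 * \<sigma> - 2 * \<sigma> * \<alpha>)"
    using r by (simp add: powr_diff power2_eq_square flip: powr_add)
  have nonneg: "0 \<le> 2 * \<sigma> * \<alpha>" "0 \<le> 2 * \<sigma> - 2 * \<sigma> * \<alpha>"
    using assms by (auto simp: mult_left_le)
  show ?thesis
  proof (cases "r \<le> 1")
    case True
    then show ?thesis unfolding eq using r by (auto intro!: min.coboundedI2 powr_mono')
  next
    case False
    then show ?thesis unfolding eq using nonneg by (auto intro!: min.coboundedI1 ge_one_powr_ge_zero)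
  qed
qed

text \<open>The Cauchy problem provides its own representatives \<open>W\<close> of the transforms; by uniqueness they
  agree almost everywhere, at each time, with the representatives chosen by \<^const>\<open>fourier_L2\<close>.\<close>

lemma solution_transform_decay:
  fixes w0 :: "real^'n \<Rightarrow> complex^3"
  assumes \<sigma>: "0 \<le> \<sigma>" and \<alpha>: "0 \<le> \<alpha>" "\<alpha> \<le> 1"
    and sol: "solves_cauchy_problem \<sigma> \<alpha> w0 w" and t: "0 \<le> t"
  defines "\<beta> \<equiv> max (2 * \<sigma> * \<alpha>) (2 * \<sigma> - 2 * \<sigma> * \<alpha>)"
  shows "\<exists>g. has_fourier_L2 (w t) g"
    and "AE \<xi> in lebesgue. (norm (fourier_L2 (w t) \<xi>))\<^sup>2
      \<le> 4 * exp (- (min 1 (norm \<xi> powr \<beta>) * t / 5)) * (norm (fourier_L2 w0 \<xi>))\<^sup>2"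
proof -
  obtain W where W: "\<And>t. t \<ge> 0 \<Longrightarrow> has_fourier_L2 (w t) (W t)"
    and ode: "AE \<xi> in lebesgue. continuous_on {0..} (\<lambda>t. W t \<xi>) \<and>
           (\<forall>t>0. ((\<lambda>t. W t \<xi>) has_vector_derivative
              (laplacian_symbol (\<sigma> / 2) \<xi> *\<^sub>R D0 + laplacian_symbol (\<sigma> * \<alpha>) \<xi> *\<^sub>R D1) *v W t \<xi>) (at t)) \<and>
           W 0 \<xi> = fourier_L2 w0 \<xi>"
    using sol unfolding solves_cauchy_problem_def by blast
  show "\<exists>g. has_fourier_L2 (w t) g" using W[OF t] by blast
  have "AE \<xi> in lebesgue. fourier_L2 (w t) \<xi> = W t \<xi>"
    using has_fourier_L2_unique has_fourier_L2_fourier_L2 W[OF t] by blast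
  moreover have "AE \<xi> in lebesgue. \<xi> \<noteq> (0 :: real^'n)"
    by (rule AE_completion[OF AE_lborel_singleton])
  ultimately show "AE \<xi> in lebesgue. (norm (fourier_L2 (w t) \<xi>))\<^sup>2
      \<le> 4 * exp (- (min 1 (norm \<xi> powr \<beta>) * t / 5)) * (norm (fourier_L2 w0 \<xi>))\<^sup>2"
    using ode
  proof eventually_elim
    case (elim \<xi>)
    define a where "a = norm \<xi> powr \<sigma>"
    define b where "b = norm \<xi> powr (2 * \<sigma> * \<alpha>)"
    have ab: "0 < a" "0 < b" using elim by (auto simp: a_def b_def)
    have sym: "laplacian_symbol (\<sigma> / 2) \<xi> = a" "laplacian_symbol (\<sigma> * \<alpha>) \<xi> = b"
      using elim by (simp_all add: laplacian_symbol_nonzero a_def b_def mult.assoc)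
    have "(norm (W t \<xi>))\<^sup>2 \<le> 4 * exp (- (min b (a\<^sup>2 / b) * t / 5)) * (norm (W 0 \<xi>))\<^sup>2"
      using elim by (intro frequency_solution_decay[OF ab _ _ t]) (auto simp: sym)
    also have "\<dots> \<le> 4 * exp (- (min 1 (norm \<xi> powr \<beta>) * t / 5)) * (norm (W 0 \<xi>))\<^sup>2"
      using decay_rate_lower_bound[OF \<sigma> \<alpha>, of "norm \<xi>"] elim t
      by (intro mult_right_mono mult_left_mono)
         (auto simp: a_def b_def \<beta>_def intro!: mult_right_mono divide_right_mono)
    finally show ?case using elim by simp
  qed
qed

text \<open>For $r \le 1$ the data enter through the pointwise bound on \<open>y\<close>, with powers of $r$ that the
  exponential turns into decay in time after integration; for $r > 1$ the exponential factor is
  independent of $r$ and the weight \<open>q\<close> must be carried by the data. The factor $e^{1/5}$ is the cost of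
  replacing $t$ by $1 + t$ in the low-frequency exponential, which makes the estimate uniform down
  to $t = 0$.\<close>

lemma low_high_frequency_split:
  fixes r s \<kappa> \<beta> t y z P N q :: real
  assumes r: "0 < r" and t: "0 \<le> t" and \<beta>: "0 \<le> \<beta>" and nonneg: "0 \<le> y"
    and z: "z\<^sup>2 \<le> 4 * exp (- (min 1 (r powr \<beta>) * t / 5)) * y\<^sup>2"
    and y: "y \<le> P + 2 * r powr \<kappa> * N" and q: "r powr s \<le> q"
  shows "(r powr s * z)\<^sup>2 \<le> 32 * exp (1/5) * P\<^sup>2 * (r powr (2 * s) * exp (- (1/5) * ((1 + t) * r powr \<beta>)))
    + 32 * exp (1/5) * N\<^sup>2 * (r powr (2 * (s + \<kappa>)) * exp (- (1/5) * ((1 + t) * r powr \<beta>)))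
    + 4 * (exp (- (t / 10)))\<^sup>2 * (q * y)\<^sup>2" (is "_ \<le> ?A + ?B + ?C")
proof (cases "r \<le> 1")
  case True
  define R where "R = r powr \<beta>"
  define e where "e = exp (1/5) * exp (- (1/5) * ((1 + t) * R))"
  have R: "R \<le> 1" using True r \<beta> by (simp add: R_def powr_le1)
  then have "exp (- (min 1 R * t / 5)) \<le> e"
    unfolding e_def exp_add[symmetric] by (simp add: field_simps)
  then have "4 * exp (- (min 1 R * t / 5)) * y\<^sup>2 \<le> 4 * e * y\<^sup>2" by (intro mult_right_mono) auto
  with z have z': "z\<^sup>2 \<le> 4 * e * y\<^sup>2" by (simp add: R_def)
  have "y\<^sup>2 \<le> (P + 2 * r powr \<kappa> * N)\<^sup>2" using y nonneg by (intro power_mono)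
  also have "\<dots> \<le> 2 * P\<^sup>2 + 2 * (2 * r powr \<kappa> * N)\<^sup>2"
    using sum_squares_bound[of P "2 * r powr \<kappa> * N"] by (simp add: power2_sum)
  also have "\<dots> \<le> 8 * P\<^sup>2 + 8 * (r powr \<kappa>)\<^sup>2 * N\<^sup>2" by (simp add: power_mult_distrib)
  finally have y': "y\<^sup>2 \<le> 8 * P\<^sup>2 + 8 * (r powr \<kappa>)\<^sup>2 * N\<^sup>2" .
  have "(r powr s * z)\<^sup>2 \<le> (r powr s)\<^sup>2 * (4 * e * (8 * P\<^sup>2 + 8 * (r powr \<kappa>)\<^sup>2 * N\<^sup>2))"
    unfolding power_mult_distrib
    using order_trans[OF z' mult_left_mono[OF y', of "4 * e"]]
    by (intro mult_left_mono) (auto simp: e_def)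
  also have "\<dots> = ?A + ?B"
  proof -
    have "r powr (2 * s) = (r powr s)\<^sup>2" for s by (simp add: power2_eq_square flip: powr_add)
    then show ?thesis by (simp add: e_def R_def powr_add power_mult_distrib algebra_simps)
  qed
  also have "\<dots> \<le> ?A + ?B + ?C" by simp
  finally show ?thesis .
next
  case False
  then have "1 \<le> r powr \<beta>" using \<beta> by (intro ge_one_powr_ge_zero) auto
  then have z': "z\<^sup>2 \<le> 4 * (exp (- (t / 10)))\<^sup>2 * y\<^sup>2"
    using z by (simp flip: exp_double)
  have "(r powr s * z)\<^sup>2 \<le> q\<^sup>2 * (4 * (exp (- (t / 10)))\<^sup>2 * y\<^sup>2)"
    unfolding power_mult_distrib using q by (intro mult_mono z' power_mono) auto
  also have "\<dots> = ?C" by (simp add: power_mult_distrib)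
  also have "\<dots> \<le> ?A + ?B + ?C" by simp
  finally show ?thesis .
qed

text \<open>Integrating the frequency-wise bound gives the square of the Riesz norm. The common exponent
  $\beta = \max(2\sigma\alpha, 2\sigma - 2\sigma\alpha)$ covers both ranges of $\alpha$, and
  $\beta \ge \sigma \ge 1$ because the two numbers add up to $2\sigma$. The square root halves the
  exponents $(n + 2s)/\beta$ and $(n + 2(s + \kappa))/\beta$ of the low-frequency integrals.\<close>

lemma riesz_norm_decay:
  fixes \<sigma> \<alpha> s \<kappa> :: real
  assumes \<sigma>: "1 \<le> \<sigma>" and \<alpha>: "0 \<le> \<alpha>" "\<alpha> \<le> 1" and s: "0 \<le> s" and \<kappa>: "0 \<le> \<kappa>" "\<kappa> \<le> 1"
  defines "\<beta> \<equiv> max (2 * \<sigma> * \<alpha>) (2 * \<sigma> - 2 * \<sigma> * \<alpha>)"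
  shows "\<exists>C>0. \<forall>(w0 :: real^'n \<Rightarrow> complex^3) w t.
      w0 \<in> bessel_space s \<longrightarrow> w0 \<in> weighted_L1 \<kappa> \<longrightarrow> solves_cauchy_problem \<sigma> \<alpha> w0 w \<longrightarrow> 0 \<le> t \<longrightarrow>
      w t \<in> riesz_space s \<and>
      riesz_norm s (w t) \<le> C *
        ((1 + t) powr (- (real CARD('n) + 2 * (s + \<kappa>)) / (2 * \<beta>)) * weighted_L1_norm \<kappa> w0
         + exp (- (t / 10)) * bessel_norm s w0
         + (1 + t) powr (- (real CARD('n) + 2 * s) / (2 * \<beta>)) * norm (total_mass w0))"
proof -
  have \<beta>: "1 \<le> \<beta>"
    using \<sigma> unfolding \<beta>_def by linarith
  let ?h = "\<lambda>m T (\<xi>::real^'n). norm \<xi> powr m * exp (- (1/5) * (T * norm \<xi> powr \<beta>))"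
  have hm: "(\<lambda>\<xi>. ennreal (?h m T \<xi>)) \<in> borel_measurable lebesgue" for m T
    by (intro measurable_completion) simp
  obtain C1 where C1: "C1 > 0" "\<And>T. T > 0 \<Longrightarrow> (\<integral>\<^sup>+\<xi>. ennreal (?h (2 * s) T \<xi>) \<partial>lebesgue)
      \<le> ennreal (C1 * T powr (- (real CARD('n) + 2 * s) / \<beta>))"
    using nn_integral_stretched_exp_le[of "2 * s" \<beta> "1/5", where 'a = "real^'n"] s \<beta>
    by (auto simp: nn_integral_completion)
  obtain C2 where C2: "C2 > 0" "\<And>T. T > 0 \<Longrightarrow> (\<integral>\<^sup>+\<xi>. ennreal (?h (2 * (s + \<kappa>)) T \<xi>) \<partial>lebesgue)
      \<le> ennreal (C2 * T powr (- (real CARD('n) + 2 * (s + \<kappa>)) / \<beta>))"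
    using nn_integral_stretched_exp_le[of "2 * (s + \<kappa>)" \<beta> "1/5", where 'a = "real^'n"] s \<kappa> \<beta>
    by (auto simp: nn_integral_completion)
  define K :: real where "K = 32 * exp (1/5)"
  define M where "M = K * C1 + K * C2 + 4"
  have K: "0 < K" by (simp add: K_def)
  have M: "0 < M" "K * C1 \<le> M" "K * C2 \<le> M" "4 \<le> M"
    using mult_pos_pos[OF K C1(1)] mult_pos_pos[OF K C2(1)] unfolding M_def by linarith+
  have "w t \<in> riesz_space s \<and>
      riesz_norm s (w t) \<le> sqrt M *
        ((1 + t) powr (- (real CARD('n) + 2 * (s + \<kappa>)) / (2 * \<beta>)) * weighted_L1_norm \<kappa> w0
         + exp (- (t / 10)) * bessel_norm s w0
         + (1 + t) powr (- (real CARD('n) + 2 * s) / (2 * \<beta>)) * norm (total_mass w0))"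
    if w0: "w0 \<in> bessel_space s" "w0 \<in> weighted_L1 \<kappa>" and sol: "solves_cauchy_problem \<sigma> \<alpha> w0 w"
      and t: "0 \<le> t" for w0 :: "real^'n \<Rightarrow> complex^3" and w t
  proof -
    have \<sigma>0: "0 \<le> \<sigma>" using \<sigma> by simp
    obtain g where wt: "has_fourier_L2 (w t) g"
      using solution_transform_decay(1)[OF \<sigma>0 \<alpha> sol t] by blast
    obtain g0 where "has_fourier_L2 w0 g0" using w0 by (auto simp: bessel_space_def)
    note w0F = has_fourier_L2_fourier_L2[OF this]
    have [measurable]: "fourier_L2 (w t) \<in> borel_measurable lebesgue" "fourier_L2 w0 \<in> borel_measurable lebesgue"
      using has_fourier_L2_fourier_L2[OF wt] w0F by (auto simp: has_fourier_L2_def L2_def)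
    let ?u = "\<lambda>\<xi>. laplacian_symbol (s / 2) \<xi> *\<^sub>R fourier_L2 (w t) \<xi>"
    let ?b = "\<lambda>\<xi>. (1 + (norm \<xi>)\<^sup>2) powr (s / 2) *\<^sub>R fourier_L2 w0 \<xi>"
    define P where "P = norm (total_mass w0)"
    define N where "N = weighted_L1_norm \<kappa> w0"
    define B where "B = bessel_norm s w0"
    define e where "e = exp (- (t / 10))"
    have nonneg: "0 \<le> P" "0 \<le> N" "0 \<le> B" "0 < e"
      by (auto simp: P_def N_def B_def e_def weighted_L1_norm_def bessel_norm_def L2_norm_def)
    have bL2: "?b \<in> L2" using w0 by (simp add: bessel_space_def)
    note decay = solution_transform_decay(2)[OF \<sigma>0 \<alpha> sol t, folded \<beta>_def]
    \<comment> \<open>The rate is nonnegative, so the solution at each time inherits the regularity of the data.\<close>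
    have uL2: "?u \<in> L2"
    proof (rule L2_dominated[OF _ bL2, where c = 2])
      show "AE \<xi> in lebesgue. norm (?u \<xi>) \<le> 2 * norm (?b \<xi>)"
        using decay
      proof eventually_elim
        case (elim \<xi>)
        also have "4 * exp (- (min 1 (norm \<xi> powr \<beta>) * t / 5)) * (norm (fourier_L2 w0 \<xi>))\<^sup>2
            \<le> 4 * 1 * (norm (fourier_L2 w0 \<xi>))\<^sup>2"
          using t by (intro mult_right_mono mult_left_mono) auto
        also have "\<dots> = (2 * norm (fourier_L2 w0 \<xi>))\<^sup>2" by (simp add: power_mult_distrib)
        finally have "norm (fourier_L2 (w t) \<xi>) \<le> 2 * norm (fourier_L2 w0 \<xi>)"
          by (rule power2_le_imp_le) simp
        then have "laplacian_symbol (s / 2) \<xi> * norm (fourier_L2 (w t) \<xi>)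
            \<le> (1 + (norm \<xi>)\<^sup>2) powr (s / 2) * (2 * norm (fourier_L2 w0 \<xi>))"
          using laplacian_symbol_le_bessel_weight[OF s, of \<xi>]
          by (intro mult_mono) (auto simp: laplacian_symbol_nonneg)
        then show ?case by (simp add: laplacian_symbol_nonneg)
      qed
    qed auto
    have riesz: "w t \<in> riesz_space s" using wt uL2 by (auto simp: riesz_space_def)
    have int: "integrable lebesgue w0" using w0 by (simp add: weighted_L1_def)
    have bound: "AE \<xi> in lebesgue. (norm (?u \<xi>))\<^sup>2
       \<le> K * P\<^sup>2 * ?h (2 * s) (1 + t) \<xi> + K * N\<^sup>2 * ?h (2 * (s + \<kappa>)) (1 + t) \<xi> + 4 * e\<^sup>2 * (norm (?b \<xi>))\<^sup>2"
      using decay fourier_L2_eq_fourier_L1[OF w0F int] AE_completion[OF AE_lborel_singleton[of 0]]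
    proof eventually_elim
      case (elim \<xi>)
      have sym: "laplacian_symbol (s / 2) \<xi> = norm \<xi> powr s"
        using elim by (simp add: laplacian_symbol_nonzero)
      have "norm (fourier_L2 w0 \<xi>) \<le> P + 2 * norm \<xi> powr \<kappa> * N"
        using norm_fourier_L1_le[OF \<kappa> w0(2)] elim by (simp add: P_def N_def)
      then show ?case
        using low_high_frequency_split[of "norm \<xi>" t \<beta> "norm (fourier_L2 w0 \<xi>)" "norm (fourier_L2 (w t) \<xi>)"
            P \<kappa> N s "(1 + (norm \<xi>)\<^sup>2) powr (s / 2)"]
          elim t \<beta> laplacian_symbol_le_bessel_weight[OF s, of \<xi>]
        by (simp add: sym K_def e_def)
    qed
    define X where "X = (1 + t) powr (- (real CARD('n) + 2 * s) / (2 * \<beta>))"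
    define Y where "Y = (1 + t) powr (- (real CARD('n) + 2 * (s + \<kappa>)) / (2 * \<beta>))"
    have X2: "(1 + t) powr (- (real CARD('n) + 2 * s) / \<beta>) = X\<^sup>2"
      and Y2: "(1 + t) powr (- (real CARD('n) + 2 * (s + \<kappa>)) / \<beta>) = Y\<^sup>2"
      using t \<beta> by (simp_all add: X_def Y_def power2_eq_square flip: powr_add)
    have "ennreal ((riesz_norm s (w t))\<^sup>2) = (\<integral>\<^sup>+\<xi>. ennreal ((norm (?u \<xi>))\<^sup>2) \<partial>lebesgue)"
      unfolding riesz_norm_def by (rule L2_norm_squared[OF uL2])
    also have "\<dots> \<le> (\<integral>\<^sup>+\<xi>. ennreal (K * P\<^sup>2) * ennreal (?h (2 * s) (1 + t) \<xi>)
        + ennreal (K * N\<^sup>2) * ennreal (?h (2 * (s + \<kappa>)) (1 + t) \<xi>)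
        + ennreal (4 * e\<^sup>2) * ennreal ((norm (?b \<xi>))\<^sup>2) \<partial>lebesgue)"
      using bound
      by (intro nn_integral_mono_AE, eventually_elim)
         (use K in \<open>simp add: ennreal_leI flip: ennreal_mult ennreal_plus del: ennreal_plus\<close>)
    also have "\<dots> = ennreal (K * P\<^sup>2) * (\<integral>\<^sup>+\<xi>. ennreal (?h (2 * s) (1 + t) \<xi>) \<partial>lebesgue)
        + ennreal (K * N\<^sup>2) * (\<integral>\<^sup>+\<xi>. ennreal (?h (2 * (s + \<kappa>)) (1 + t) \<xi>) \<partial>lebesgue)
        + ennreal (4 * e\<^sup>2) * (\<integral>\<^sup>+\<xi>. ennreal ((norm (?b \<xi>))\<^sup>2) \<partial>lebesgue)"
      by (intro nn_integral_combination_of_three hm) measurable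
    also have "\<dots> \<le> ennreal (K * P\<^sup>2) * ennreal (C1 * X\<^sup>2) + ennreal (K * N\<^sup>2) * ennreal (C2 * Y\<^sup>2)
        + ennreal (4 * e\<^sup>2) * ennreal (B\<^sup>2)"
      using C1(2)[of "1 + t"] C2(2)[of "1 + t"] t
      unfolding X2 Y2 B_def bessel_norm_def L2_norm_squared[OF bL2]
      by (intro add_mono mult_left_mono) auto
    also have "\<dots> = ennreal (K * P\<^sup>2 * (C1 * X\<^sup>2) + K * N\<^sup>2 * (C2 * Y\<^sup>2) + 4 * e\<^sup>2 * B\<^sup>2)"
      using K C1(1) C2(1) by (simp add: ennreal_mult ennreal_plus)
    finally have "(riesz_norm s (w t))\<^sup>2 \<le> K * P\<^sup>2 * (C1 * X\<^sup>2) + K * N\<^sup>2 * (C2 * Y\<^sup>2) + 4 * e\<^sup>2 * B\<^sup>2"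
      using K C1(1) C2(1) by (subst (asm) ennreal_le_iff) auto
    also have "\<dots> = (K * C1) * (X * P)\<^sup>2 + (K * C2) * (Y * N)\<^sup>2 + 4 * (e * B)\<^sup>2"
      by (simp add: power_mult_distrib)
    also have "\<dots> \<le> M * (X * P)\<^sup>2 + M * (Y * N)\<^sup>2 + M * (e * B)\<^sup>2"
      using M by (intro add_mono mult_right_mono) auto
    also have "\<dots> \<le> M * (Y * N + e * B + X * P)\<^sup>2"
    proof -
      have "(X * P)\<^sup>2 + (Y * N)\<^sup>2 + (e * B)\<^sup>2 \<le> (Y * N + e * B + X * P)\<^sup>2"
        using nonneg by (simp add: power2_sum X_def Y_def algebra_simps)
      then show ?thesis using M by (simp flip: distrib_left)
    qed
    also have "\<dots> = (sqrt M * (Y * N + e * B + X * P))\<^sup>2" using M by (simp add: power_mult_distrib)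
    finally have "riesz_norm s (w t) \<le> sqrt M * (Y * N + e * B + X * P)"
      by (rule power2_le_imp_le) (use nonneg M in \<open>auto simp: X_def Y_def\<close>)
    with riesz show ?thesis by (simp add: X_def Y_def e_def N_def P_def B_def)
  qed
  then show ?thesis using M by (intro exI[of _ "sqrt M"]) auto
qed

theorem theorem5p1:
  fixes \<sigma> \<alpha> s \<kappa> :: real
  assumes "\<sigma> \<ge> 1" and "0 \<le> \<alpha>" and "\<alpha> \<le> 1" and "s \<ge> 0" and "0 \<le> \<kappa>" and "\<kappa> \<le> 1"
  shows "\<exists>c>0. \<forall>s\<^sub>0. 0 \<le> s\<^sub>0 \<and> s\<^sub>0 \<le> s \<longrightarrow> (\<exists>C>0.
    \<forall>(w0 :: real^'n \<Rightarrow> complex^3) w. w0 \<in> bessel_space s \<inter> weighted_L1 \<kappa> \<longrightarrow>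
      solves_cauchy_problem \<sigma> \<alpha> w0 w \<longrightarrow>
      (\<forall>t\<ge>0. w t \<in> riesz_space s\<^sub>0 \<and>
        (\<alpha> \<le> 1/2 \<longrightarrow> riesz_norm s\<^sub>0 (w t) \<le> C *
           ((1 + t) powr (- (real CARD('n) + 2 * (s\<^sub>0 + \<kappa>)) / (2 * (2 * \<sigma> - 2 * \<sigma> * \<alpha>)))
              * weighted_L1_norm \<kappa> w0
            + exp (- c * t) * bessel_norm s\<^sub>0 w0
            + (1 + t) powr (- (real CARD('n) + 2 * s\<^sub>0) / (2 * (2 * \<sigma> - 2 * \<sigma> * \<alpha>)))
              * norm (total_mass w0))) \<and>
        (\<alpha> > 1/2 \<longrightarrow> riesz_norm s\<^sub>0 (w t) \<le> C *
           ((1 + t) powr (- (real CARD('n) + 2 * (s\<^sub>0 + \<kappa>)) / (4 * \<sigma> * \<alpha>))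
              * weighted_L1_norm \<kappa> w0
            + exp (- c * t) * bessel_norm s\<^sub>0 w0
            + (1 + t) powr (- (real CARD('n) + 2 * s\<^sub>0) / (4 * \<sigma> * \<alpha>))
              * norm (total_mass w0)))))"
proof (rule exI[of _ "1/10 :: real"], intro conjI allI impI, goal_cases)
  case (2 s\<^sub>0)
  then have s\<^sub>0: "0 \<le> s\<^sub>0" "s\<^sub>0 \<le> s" by auto
  define \<beta> where "\<beta> = max (2 * \<sigma> * \<alpha>) (2 * \<sigma> - 2 * \<sigma> * \<alpha>)"
  obtain C where C: "C > 0" "\<And>(w0 :: real^'n \<Rightarrow> complex^3) w t.
      w0 \<in> bessel_space s\<^sub>0 \<Longrightarrow> w0 \<in> weighted_L1 \<kappa> \<Longrightarrow> solves_cauchy_problem \<sigma> \<alpha> w0 w \<Longrightarrow> 0 \<le> t \<Longrightarrow>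
      w t \<in> riesz_space s\<^sub>0 \<and>
      riesz_norm s\<^sub>0 (w t) \<le> C *
        ((1 + t) powr (- (real CARD('n) + 2 * (s\<^sub>0 + \<kappa>)) / (2 * \<beta>)) * weighted_L1_norm \<kappa> w0
         + exp (- (t / 10)) * bessel_norm s\<^sub>0 w0
         + (1 + t) powr (- (real CARD('n) + 2 * s\<^sub>0) / (2 * \<beta>)) * norm (total_mass w0))"
    using riesz_norm_decay[OF assms(1-3) _ assms(5,6), of s\<^sub>0, where 'n = 'n] s\<^sub>0 unfolding \<beta>_def by blast
  have low: "\<beta> = 2 * \<sigma> - 2 * \<sigma> * \<alpha>" if "\<alpha> \<le> 1/2"
    using mult_left_mono[OF that, of "4 * \<sigma>"] assms by (simp add: \<beta>_def)
  have high: "2 * \<beta> = 4 * \<sigma> * \<alpha>" if "\<alpha> > 1/2"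
    using mult_left_mono[of "1/2" \<alpha> "4 * \<sigma>"] that assms by (simp add: \<beta>_def)
  show ?case
  proof (intro exI[of _ C] conjI allI impI, goal_cases)
    case 1
    show ?case by (rule C(1))
  next
    case (2 w0 w t)
    then show ?case using C(2)[of w0 w t] bessel_space_mono[of w0 s s\<^sub>0] s\<^sub>0 by blast
  next
    case (3 w0 w t)
    then show ?case using C(2)[of w0 w t] bessel_space_mono[of w0 s s\<^sub>0] s\<^sub>0 low by simp
  next
    case (4 w0 w t)
    then show ?case using C(2)[of w0 w t] bessel_space_mono[of w0 s s\<^sub>0] s\<^sub>0 high by simp
  qed
qed simp

end
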